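(* Let $f\colon\mathbb{R}^n\to\mathbb{R}^n$, $g\colon\mathbb{R}^n\to\mathbb{R}^{n,m}$, $h\colon\mathbb{R}^n\to\mathbb{R}^m$ be continuous with $f(0)=0$, and let the plant $\dot z=f(z)+g(z)u$, $y=h(z)$ be passive with storage function $\mathcal{H}$. Let $\hat{\mathcal{H}}$ be the value function described in the context and let the smoothness and balancing assumptions listed in the context hold. Further, assume that the plant is semibalanced with respect to $\mathcal{H}$ and $\hat{\mathcal{H}}$, and that there is a function $r\colon\mathbb{R}^n\to\mathbb{R}^n$ with $$f(z)=-r(\nabla\mathcal{H}(z)),\qquad v^{\mathsf T}r(v)\ge0\qquad\text{for all }z,v\in\mathbb{R}^n.$$ If we partition $z=(z_1,z_2)$ with $z_1\in\mathbb{R}^k$, $k\le n$ arbitrary, and accordingly $$r(z)=\begin{bmatrix}r_1(z_1,z_2)\\ r_2(z_1,z_2)\end{bmatrix},\qquad g(z)=\begin{bmatrix}g_1(z_1,z_2)\\ g_2(z_1,z_2)\end{bmatrix},$$ then the reduced order model $$\dot z_1=-r_1(z_1,0)+g_1(z_1,0)u,\qquad y_1=g_1(z_1,0)^{\mathsf T}z_1$$ is passive.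
   Context: Plant: $\dot z=f(z)+g(z)u$, $z(0)=z_0$, $y=h(z)$; solutions are assumed to exist on $[0,\infty)$ in the sense of Carathéodory. A system with state $z$, input $u$, output $y$ is passive if there is a function $\mathcal{H}\ge0$ of the state (a storage function) with $\mathcal{H}(z(t_1))-\mathcal{H}(z(t_0))\le\int_{t_0}^{t_1}y^{\mathsf T}u\,\mathrm{d}t$ for all $t_1\ge t_0\ge0$ and all controls $u$ along solutions. Value function: $\hat{\mathcal{H}}(z_0)=\inf_{u\in\mathcal{U}_{\mathrm{ad}}(z_0)}\frac12\int_0^\infty y^{\mathsf T}\mathbf{Q}y+u^{\mathsf T}\mathbf{R}u\,\mathrm{d}t$ subject to the plant dynamics with $z(0)=z_0$, where $\mathbf{Q},\mathbf{R}\in\mathbb{R}^{m,m}$ are symmetric positive semidefinite, $\mathbf{R}$ invertible, and $\mathcal{U}_{\mathrm{ad}}(z_0)$ is the set of $u\in L^2([0,\infty),\mathbb{R}^m)$ rendering the integral finite. Smoothness and balancing assumptions. (1) $\mathcal{U}_{\mathrm{ad}}(z_0)\neq\emptyset$ for all $z_0$, $\hat{\mathcal{H}}$ is continuously differentiable, and $u^*(z)=-\mathbf{R}^{-1}g(z)^{\mathsf T}\nabla\hat{\mathcal{H}}(z)$ is an optimal feedback law. (2) For some integer $\kappa\ge2$: $\mathcal{H}\in C^{\kappa+2}$, $\hat{\mathcal{H}}\in C^\kappa$, $\mathcal{H}(0)=\hat{\mathcal{H}}(0)=0$, $\nabla\mathcal{H}(0)=0$, $\nabla^2\mathcal{H}(0)\succ0$,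 $\nabla^2\hat{\mathcal{H}}(0)\succ0$. Under (2) there are an open $V\ni0$, a $C^\kappa$-isomorphism $\phi$ (a $C^\kappa$ bijection with $C^\kappa$ inverse) from an open neighbourhood of $0$ onto $V$ with $\phi(0)=0$, and a pointwise symmetric positive definite $C^{\kappa-2}$ function $\hat{\mathsf{H}}\colon V\to\mathbb{R}^{n,n}$ with $(\mathcal{H}\circ\phi^{-1})(\bar z)=\frac12\bar z^{\mathsf T}\bar z$ and $(\hat{\mathcal{H}}\circ\phi^{-1})(\bar z)=\frac12\bar z^{\mathsf T}\hat{\mathsf{H}}(\bar z)\bar z$ on $V$; write $\hat{\mathsf{H}}(\bar z)=T(\bar z)D(\bar z)T(\bar z)^{\mathsf T}$ with $D$ pointwise diagonal and $T$ pointwise orthogonal. (3) $\theta\colon V\to\theta(V)$, $\bar z\mapsto T(\bar z)^{\mathsf T}\bar z$, is a $C^{\kappa-2}$-isomorphism. In the coordinates $\tilde z=(\theta\circ\phi)(z)$, $\mathcal{H}$ becomes $\frac12\tilde z^{\mathsf T}\tilde z$ and $\hat{\mathcal{H}}$ becomes $\frac12\tilde z^{\mathsf T}\Sigma(\tilde z)\tilde z$ with $\Sigma$ of class $C^{\kappa-2}$ and pointwise diagonal with positive entries. The plant is called semibalanced with respect to $\mathcal{H}$ and $\hat{\mathcal{H}}$ if it is already given in such coordinates, i.e. $\mathcal{H}(z)=\frac12z^{\mathsf T}z$ (so $\nabla\mathcal{H}(z)=z$) and $\hat{\mathcal{H}}(z)=\frac12z^{\mathsf T}\Sigma(z)z$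 with such a $\Sigma$ on the coordinate domain. *)

theory Defs
  imports "HOL-Analysis.Analysis"
begin

section \<open>Differential calculus and matrices\<close>

text \<open>Continuous differentiability of order \<open>k\<close> on an open set. In finite dimension all iterated
  directional derivatives being continuous is the same as the \<open>k\<close>-th Frechet derivative being
  continuous.\<close>

fun Ck_on :: "nat \<Rightarrow> 'a::euclidean_space set \<Rightarrow> ('a \<Rightarrow> 'b::real_normed_vector) \<Rightarrow> bool" where
  "Ck_on 0 S f \<longleftrightarrow> continuous_on S f"
| "Ck_on (Suc k) S f \<longleftrightarrow>
     (\<forall>x\<in>S. f differentiable (at x)) \<and> (\<forall>v. Ck_on k S (\<lambda>x. frechet_derivative f (at x) v))"

definition Ck_isomorphism ::
    "nat \<Rightarrow> 'a::euclidean_space set \<Rightarrow> 'b::euclidean_space set \<Rightarrow> ('a \<Rightarrow> 'b) \<Rightarrow> bool" where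
  "Ck_isomorphism k S T f \<longleftrightarrow>
     open S \<and> open T \<and> bij_betw f S T \<and> Ck_on k S f \<and> Ck_on k T (inv_into S f)"

definition gradient :: "('a::euclidean_space \<Rightarrow> real) \<Rightarrow> 'a \<Rightarrow> 'a" where
  "gradient F x = (THE d. GDERIV F x :> d)"

definition hessian :: "(real^'n \<Rightarrow> real) \<Rightarrow> real^'n \<Rightarrow> real^'n^'n" where
  "hessian F x = matrix (frechet_derivative (gradient F) (at x))"

definition sym_pos_semidef :: "real^'n^'n \<Rightarrow> bool" where
  "sym_pos_semidef A \<longleftrightarrow> transpose A = A \<and> (\<forall>x. x \<bullet> (A *v x) \<ge> 0)"

definition sym_pos_def :: "real^'n^'n \<Rightarrow> bool" where
  "sym_pos_def A \<longleftrightarrow> transpose A = A \<and> (\<forall>x. x \<noteq> 0 \<longrightarrow> x \<bullet> (A *v x) > 0)"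

definition diagonal_matrix :: "real^'n^'n \<Rightarrow> bool" where
  "diagonal_matrix A \<longleftrightarrow> (\<forall>i j. i \<noteq> j \<longrightarrow> A $ i $ j = 0)"


section \<open>Input-affine systems and passivity\<close>

definition control :: "(real \<Rightarrow> real^'m) \<Rightarrow> bool" where
  "control u \<longleftrightarrow> (\<forall>T. u absolutely_integrable_on {0..T})"

text \<open>Caratheodory solutions of \<open>z' = f z + g z u\<close> on \<open>[0, T]\<close>, in integral form: this is absolute
  continuity of \<open>z\<close> together with the differential equation almost everywhere.\<close>

definition solution_upto ::
    "real \<Rightarrow> (real^'n \<Rightarrow> real^'n) \<Rightarrow> (real^'n \<Rightarrow> real^'m^'n) \<Rightarrow>
     (real \<Rightarrow> real^'m) \<Rightarrow> (real \<Rightarrow> real^'n) \<Rightarrow> bool" where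
  "solution_upto T f g u z \<longleftrightarrow>
     (\<lambda>s. f (z s) + g (z s) *v u s) absolutely_integrable_on {0..T} \<and>
     (\<forall>t\<in>{0..T}. z t = z 0 + integral {0..t} (\<lambda>s. f (z s) + g (z s) *v u s))"

definition solution ::
    "(real^'n \<Rightarrow> real^'n) \<Rightarrow> (real^'n \<Rightarrow> real^'m^'n) \<Rightarrow>
     (real \<Rightarrow> real^'m) \<Rightarrow> real^'n \<Rightarrow> (real \<Rightarrow> real^'n) \<Rightarrow> bool" where
  "solution f g u z0 z \<longleftrightarrow> z 0 = z0 \<and> (\<forall>T\<ge>0. solution_upto T f g u z)"

text \<open>The dissipation inequality is required up to any time \<open>t1\<close> to which a solution exists, so
  that solutions with finite escape time are not ignored. When all solutions can be continued to
  \<open>[0, \<infinity>)\<close> this is the inequality along solutions on \<open>[0, \<infinity>)\<close>. The supply rate \<open>h (z t) \<bullet> u t\<close> is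
  Lebesgue integrable on \<open>[t0, t1]\<close> as soon as \<open>h\<close> is continuous.\<close>

definition storage_function ::
    "(real^'n \<Rightarrow> real^'n) \<Rightarrow> (real^'n \<Rightarrow> real^'m^'n) \<Rightarrow> (real^'n \<Rightarrow> real^'m) \<Rightarrow>
     (real^'n \<Rightarrow> real) \<Rightarrow> bool" where
  "storage_function f g h H \<longleftrightarrow>
     (\<forall>z. H z \<ge> 0) \<and>
     (\<forall>u z t0 t1. control u \<longrightarrow> 0 \<le> t0 \<longrightarrow> t0 \<le> t1 \<longrightarrow> solution_upto t1 f g u z \<longrightarrow>
        H (z t1) - H (z t0) \<le> integral {t0..t1} (\<lambda>t. h (z t) \<bullet> u t))"

definition passive_system ::
    "(real^'n \<Rightarrow> real^'n) \<Rightarrow> (real^'n \<Rightarrow> real^'m^'n) \<Rightarrow> (real^'n \<Rightarrow> real^'m) \<Rightarrow> bool" where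
  "passive_system f g h \<longleftrightarrow> (\<exists>H. storage_function f g h H)"


section \<open>The optimal control problem\<close>

definition square_integrable :: "(real \<Rightarrow> real^'m) \<Rightarrow> bool" where
  "square_integrable u \<longleftrightarrow>
     set_borel_measurable lebesgue {0..} u \<and>
     (\<lambda>t. (norm (u t))\<^sup>2) absolutely_integrable_on {0..}"

definition running_cost ::
    "(real^'n \<Rightarrow> real^'m) \<Rightarrow> real^'m^'m \<Rightarrow> real^'m^'m \<Rightarrow>
     (real \<Rightarrow> real^'m) \<Rightarrow> (real \<Rightarrow> real^'n) \<Rightarrow> real \<Rightarrow> real" where
  "running_cost h Q R u z t = h (z t) \<bullet> (Q *v h (z t)) + u t \<bullet> (R *v u t)"

definition cost ::
    "(real^'n \<Rightarrow> real^'m) \<Rightarrow> real^'m^'m \<Rightarrow> real^'m^'m \<Rightarrow>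
     (real \<Rightarrow> real^'m) \<Rightarrow> (real \<Rightarrow> real^'n) \<Rightarrow> real" where
  "cost h Q R u z = 1/2 * integral {0..} (running_cost h Q R u z)"

text \<open>As \<open>f\<close> and \<open>g\<close> are only continuous, a control need not determine the trajectory; admissible
  controls are therefore paired with a trajectory of finite cost.\<close>

definition admissible_pairs ::
    "(real^'n \<Rightarrow> real^'n) \<Rightarrow> (real^'n \<Rightarrow> real^'m^'n) \<Rightarrow> (real^'n \<Rightarrow> real^'m) \<Rightarrow>
     real^'m^'m \<Rightarrow> real^'m^'m \<Rightarrow> real^'n \<Rightarrow> ((real \<Rightarrow> real^'m) \<times> (real \<Rightarrow> real^'n)) set" where
  "admissible_pairs f g h Q R z0 =
     {(u, z). square_integrable u \<and> solution f g u z0 z \<and>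
              running_cost h Q R u z absolutely_integrable_on {0..}}"

definition admissible_controls ::
    "(real^'n \<Rightarrow> real^'n) \<Rightarrow> (real^'n \<Rightarrow> real^'m^'n) \<Rightarrow> (real^'n \<Rightarrow> real^'m) \<Rightarrow>
     real^'m^'m \<Rightarrow> real^'m^'m \<Rightarrow> real^'n \<Rightarrow> (real \<Rightarrow> real^'m) set" where
  "admissible_controls f g h Q R z0 = fst ` admissible_pairs f g h Q R z0"

definition value_function ::
    "(real^'n \<Rightarrow> real^'n) \<Rightarrow> (real^'n \<Rightarrow> real^'m^'n) \<Rightarrow> (real^'n \<Rightarrow> real^'m) \<Rightarrow>
     real^'m^'m \<Rightarrow> real^'m^'m \<Rightarrow> real^'n \<Rightarrow> real" where
  "value_function f g h Q R z0 = (INF (u, z)\<in>admissible_pairs f g h Q R z0. cost h Q R u z)"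

definition optimal_feedback ::
    "(real^'n \<Rightarrow> real^'n) \<Rightarrow> (real^'n \<Rightarrow> real^'m^'n) \<Rightarrow> (real^'n \<Rightarrow> real^'m) \<Rightarrow>
     real^'m^'m \<Rightarrow> real^'m^'m \<Rightarrow> (real^'n \<Rightarrow> real^'m) \<Rightarrow> bool" where
  "optimal_feedback f g h Q R k \<longleftrightarrow>
     (\<forall>z0. (\<exists>z. solution f g (k \<circ> z) z0 z) \<and>
           (\<forall>z. solution f g (k \<circ> z) z0 z \<longrightarrow>
              (k \<circ> z, z) \<in> admissible_pairs f g h Q R z0 \<and>
              cost h Q R (k \<circ> z) z = value_function f g h Q R z0))"


section \<open>Balancing\<close>

text \<open>In the coordinates \<open>\<phi>\<close>, \<open>H\<close> is \<open>1/2 |x|\<^sup>2\<close> and \<open>Hhat\<close> has the state-dependent matrix \<open>M\<close>, which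
  the orthogonal \<open>T\<close> diagonalizes pointwise. No regularity of \<open>T\<close> and \<open>D\<close> is asked for beyond
  \<open>x \<mapsto> T(x)\<^sup>T x\<close> being an isomorphism of class \<open>\<kappa> - 2\<close>; the natural-number subtraction is meant
  for \<open>\<kappa> \<ge> 2\<close>.\<close>

definition balancing_assumption ::
    "nat \<Rightarrow> (real^'n \<Rightarrow> real) \<Rightarrow> (real^'n \<Rightarrow> real) \<Rightarrow> bool" where
  "balancing_assumption \<kappa> H Hhat \<longleftrightarrow>
     (\<exists>(U :: (real^'n) set) (V :: (real^'n) set) \<phi>
        (M :: real^'n \<Rightarrow> real^'n^'n) (T :: real^'n \<Rightarrow> real^'n^'n) (D :: real^'n \<Rightarrow> real^'n^'n).
        0 \<in> U \<and> 0 \<in> V \<and> \<phi> 0 = 0 \<and> Ck_isomorphism \<kappa> U V \<phi> \<and>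
        Ck_on (\<kappa> - 2) V M \<and> (\<forall>x\<in>V. sym_pos_def (M x)) \<and>
        (\<forall>x\<in>V. H (inv_into U \<phi> x) = 1/2 * (x \<bullet> x)) \<and>
        (\<forall>x\<in>V. Hhat (inv_into U \<phi> x) = 1/2 * (x \<bullet> (M x *v x))) \<and>
        (\<forall>x\<in>V. M x = T x ** D x ** transpose (T x)) \<and>
        (\<forall>x\<in>V. orthogonal_matrix (T x) \<and> diagonal_matrix (D x)) \<and>
        (let \<theta> = (\<lambda>x. transpose (T x) *v x) in Ck_isomorphism (\<kappa> - 2) V (\<theta> ` V) \<theta>))"

text \<open>\<open>W\<close> is the domain of the balanced coordinates; it may be all of the state space.\<close>

definition semibalanced ::
    "nat \<Rightarrow> (real^'n \<Rightarrow> real) \<Rightarrow> (real^'n \<Rightarrow> real) \<Rightarrow> bool" where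
  "semibalanced \<kappa> H Hhat \<longleftrightarrow>
     (\<exists>W \<Sigma>. open W \<and> 0 \<in> W \<and> Ck_on (\<kappa> - 2) W \<Sigma> \<and>
        (\<forall>z\<in>W. diagonal_matrix (\<Sigma> z) \<and> (\<forall>i. \<Sigma> z $ i $ i > 0)) \<and>
        (\<forall>z\<in>W. H z = 1/2 * (z \<bullet> z)) \<and>
        (\<forall>z\<in>W. Hhat z = 1/2 * (z \<bullet> (\<Sigma> z *v z))))"


section \<open>Partitioned vectors\<close>

text \<open>An injection \<open>p :: 'k \<Rightarrow> 'n\<close> selects the coordinates that form the block \<open>z\<^sub>1\<close> of a partitioned
  vector \<open>z = (z\<^sub>1, z\<^sub>2)\<close>. Unlike a sum type of indices, this allows \<open>z\<^sub>2\<close> to be empty.\<close>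

definition block1 :: "('k \<Rightarrow> 'n) \<Rightarrow> 'a^'n \<Rightarrow> 'a^'k" where
  "block1 p z = (\<chi> i. z $ p i)"

definition pad0 :: "('k \<Rightarrow> 'n) \<Rightarrow> real^'k \<Rightarrow> real^'n" where
  "pad0 p z1 = (\<chi> j. if j \<in> range p then z1 $ inv p j else 0)"

definition reduced_f ::
    "('k \<Rightarrow> 'n) \<Rightarrow> (real^'n \<Rightarrow> real^'n) \<Rightarrow> real^'k \<Rightarrow> real^'k" where
  "reduced_f p r z1 = - block1 p (r (pad0 p z1))"

text \<open>On a matrix, \<open>block1\<close> selects rows.\<close>

definition reduced_g ::
    "('k \<Rightarrow> 'n) \<Rightarrow> (real^'n \<Rightarrow> real^'m^'n) \<Rightarrow> real^'k \<Rightarrow> real^'m^'k" where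
  "reduced_g p g z1 = block1 p (g (pad0 p z1))"

definition reduced_h ::
    "('k \<Rightarrow> 'n) \<Rightarrow> (real^'n \<Rightarrow> real^'m^'n) \<Rightarrow> real^'k \<Rightarrow> real^'m" where
  "reduced_h p g z1 = transpose (reduced_g p g z1) *v z1"

end

theory Submission
  imports Defs
begin

text \<open>Along the reduced model, \<open>1/2 |z\<^sub>1|\<^sup>2\<close> has derivative
  \<open>- z\<^sub>1 \<bullet> r\<^sub>1(z\<^sub>1, 0) + z\<^sub>1 \<bullet> g\<^sub>1(z\<^sub>1, 0) u\<close> almost everywhere. The first term equals
  \<open>- v \<bullet> r(v)\<close> for \<open>v = (z\<^sub>1, 0)\<close>, hence is nonpositive, and the second is \<open>y\<^sub>1 \<bullet> u\<close>. So
  \<open>1/2 |z\<^sub>1|\<^sup>2\<close> is a storage function.\<close>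

text \<open>A continuous factor on a compact interval is bounded and measurable, and such a factor
  preserves absolute integrability. This serves both for \<open>z \<bullet> w\<close> and for the
  supply rate, where the other factor is only integrable.\<close>

lemma absolutely_integrable_continuous_inner:
  fixes f w :: "real \<Rightarrow> 'a::euclidean_space"
  assumes "continuous_on {a..b} f" and "w absolutely_integrable_on {a..b}"
  shows "(\<lambda>s. f s \<bullet> w s) absolutely_integrable_on {a..b}"
proof -
  have bil: "bilinear ((\<bullet>) :: 'a \<Rightarrow> 'a \<Rightarrow> real)"
    using bilinear_conv_bounded_bilinear bounded_bilinear_inner by blast
  have "f \<in> borel_measurable (lebesgue_on {a..b})"
    by (rule continuous_imp_measurable_on_sets_lebesgue[OF assms(1)]) simp
  moreover have "bounded (f ` {a..b})"
    using assms(1) compact_continuous_image compact_imp_bounded by blast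
  ultimately show ?thesis
    using absolutely_integrable_bounded_measurable_product[OF bil _ _ _ assms(2)] by simp
qed

text \<open>On a short interval \<open>[c, d]\<close> the increment \<open>(|z d|\<^sup>2 - |z c|\<^sup>2) / 2\<close> is the integral of
  \<open>m \<bullet> w\<close> for the midpoint \<open>m = (z c + z d) / 2\<close>, and uniform continuity of \<open>z\<close> makes \<open>m\<close> close
  to \<open>z\<close> there; the errors then add up to at most \<open>\<epsilon>\<close> times the integral of \<open>|w|\<close>.\<close>

lemma integral_inner_indefinite_integral:
  fixes w z :: "real \<Rightarrow> 'a::euclidean_space"
  assumes ab: "a \<le> b" and w: "w absolutely_integrable_on {a..b}"
    and z: "\<And>t. t \<in> {a..b} \<Longrightarrow> z t = z a + integral {a..t} w"
  shows "integral {a..b} (\<lambda>s. z s \<bullet> w s) = (z b \<bullet> z b - z a \<bullet> z a) / 2"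
proof -
  have w_int: "w integrable_on {a..b}" and nw_int: "(\<lambda>s. norm (w s)) integrable_on {a..b}"
    using w by (auto simp: absolutely_integrable_on_def)
  have cont: "continuous_on {a..b} z"
  proof (rule continuous_on_eq)
    show "continuous_on {a..b} (\<lambda>t. z a + integral {a..t} w)"
      by (intro continuous_intros indefinite_integral_continuous_1 w_int)
  qed (simp add: z[symmetric])
  have zw_int: "(\<lambda>s. z s \<bullet> w s) integrable_on {a..b}"
    using absolutely_integrable_continuous_inner[OF cont w] by (simp add: absolutely_integrable_on_def)
  \<comment> \<open>\<open>E c d\<close> is the defect of the claimed identity on
    \<open>{c..d}\<close>. Since \<open>E\<close> and \<open>N\<close> are both additive over
    adjacent intervals, a bound of \<open>\<bar>E\<bar>\<close> by \<open>\<epsilon> * N\<close> on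
    short intervals passes to their union.\<close>
  define E where "E c d = (z d \<bullet> z d - z c \<bullet> z c) / 2 - integral {c..d} (\<lambda>s. z s \<bullet> w s)" for c d
  define N where "N c d = integral {c..d} (\<lambda>s. norm (w s))" for c d
  have E_add: "E c e = E c d + E d e" and N_add: "N c e = N c d + N d e"
    if "a \<le> c" "c \<le> d" "d \<le> e" "e \<le> b" for c d e
  proof -
    have sub: "{c..e} \<subseteq> {a..b}" using that by auto
    show "E c e = E c d + E d e"
      using Henstock_Kurzweil_Integration.integral_combine
        [OF that(2,3) integrable_on_subinterval[OF zw_int sub]]
      by (simp add: E_def field_simps)
    show "N c e = N c d + N d e"
      using Henstock_Kurzweil_Integration.integral_combine
        [OF that(2,3) integrable_on_subinterval[OF nw_int sub]]
      by (simp add: N_def)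
  qed
  have short: "\<bar>E c d\<bar> \<le> \<epsilon> * N c d"
    if cd: "a \<le> c" "c \<le> d" "d \<le> b" 
      and osc: "\<And>s t. s \<in> {c..d} \<Longrightarrow> t \<in> {c..d} \<Longrightarrow> norm (z s - z t) \<le> \<epsilon>" for c d \<epsilon>
  proof -
    define m where "m = (1/2) *\<^sub>R (z c + z d)"
    have sub: "{c..d} \<subseteq> {a..b}" using cd by auto
    note ints = integrable_on_subinterval[OF w_int sub] integrable_on_subinterval[OF zw_int sub]
      integrable_on_subinterval[OF nw_int sub]
    have "integral {a..c} w + integral {c..d} w = integral {a..d} w"
      by (rule Henstock_Kurzweil_Integration.integral_combine)
        (use cd in \<open>auto intro: integrable_on_subinterval[OF w_int]\<close>)
    then have "z d - z c = integral {c..d} w"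
      using z[of c] z[of d] cd by (simp add: algebra_simps)
    \<comment> \<open>The midpoint makes this increment exact, with no second-order remainder, so
      that \<open>E c d\<close> only measures how far \<open>z\<close> strays from
      \<open>m\<close>.\<close>
    moreover have "(z d \<bullet> z d - z c \<bullet> z c) / 2 = m \<bullet> (z d - z c)"
      by (simp add: m_def inner_simps inner_commute field_simps)
    moreover have "integral {c..d} (\<lambda>s. m \<bullet> w s) = m \<bullet> integral {c..d} w"
      using integral_linear[OF ints(1) bounded_linear_inner_right[of m]] by (simp add: o_def)
    moreover have m_int: "(\<lambda>s. m \<bullet> w s) integrable_on {c..d}"
      using integrable_linear[OF ints(1) bounded_linear_inner_right[of m]] by (simp add: o_def)
    ultimately have E_eq: "E c d = integral {c..d} (\<lambda>s. (m - z s) \<bullet> w s)"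
      using ints(2) by (simp add: E_def inner_diff_left integral_diff)
    have near: "norm (m - z s) \<le> \<epsilon>" if s: "s \<in> {c..d}" for s
    proof -
      have "m - z s = (1/2) *\<^sub>R ((z c - z s) + (z d - z s))"
        by (simp add: m_def algebra_simps flip: scaleR_add_left)
      then have "norm (m - z s) \<le> (norm (z c - z s) + norm (z d - z s)) / 2"
        using norm_triangle_ineq[of "z c - z s" "z d - z s"] by simp
      also have "\<dots> \<le> \<epsilon>" using osc[of c s] osc[of d s] s cd by auto
      finally show ?thesis .
    qed
    have "norm (integral {c..d} (\<lambda>s. (m - z s) \<bullet> w s)) \<le> integral {c..d} (\<lambda>s. \<epsilon> * norm (w s))"
    proof (rule Henstock_Kurzweil_Integration.integral_norm_bound_integral)
      show "(\<lambda>s. (m - z s) \<bullet> w s) integrable_on {c..d}"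
        using integrable_diff[OF m_int ints(2)] by (simp add: inner_diff_left)
      show "(\<lambda>s. \<epsilon> * norm (w s)) integrable_on {c..d}"
        using integrable_cmul[OF ints(3), of \<epsilon>] by simp
      show "norm ((m - z s) \<bullet> w s) \<le> \<epsilon> * norm (w s)" if "s \<in> {c..d}" for s
        using Cauchy_Schwarz_ineq2[of "m - z s" "w s"] mult_right_mono[OF near[OF that], of "norm (w s)"]
        by simp
    qed
    then show ?thesis by (simp add: E_eq N_def)
  qed
  have bound: "\<bar>E a b\<bar> \<le> \<epsilon> * N a b" if "\<epsilon> > 0" for \<epsilon>
  proof -
    have "uniformly_continuous_on {a..b} z"
      using cont compact_uniformly_continuous by blast
    then obtain \<delta> where \<delta>: "\<delta> > 0"
      and close: "\<And>s t. s \<in> {a..b} \<Longrightarrow> t \<in> {a..b} \<Longrightarrow> dist s t < \<delta> \<Longrightarrow> dist (z s) (z t) < \<epsilon>"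
      using \<open>\<epsilon> > 0\<close> unfolding uniformly_continuous_on_def by metis
    \<comment> \<open>Induction on the number of steps of length \<open>\<delta> / 2\<close> that
      suffice to reach \<open>t\<close> from \<open>a\<close>.\<close>
    have "\<bar>E a t\<bar> \<le> \<epsilon> * N a t" if "t \<in> {a..b}" "t - a \<le> real n * (\<delta> / 2)" for n t
      using that
    proof (induction n arbitrary: t)
      case 0
      then have "t = a" by auto
      then show ?case by (simp add: E_def N_def)
    next
      case (Suc n)
      \<comment> \<open>One step back from \<open>t\<close>, clipped at \<open>a\<close> so as to
        stay in the interval. Half of \<open>\<delta>\<close> is used because \<open>close\<close>
        needs strict inequality, while the closed interval \<open>{c..t}\<close> contains points at
        distance exactly \<open>t - c\<close>.\<close>
      define c where "c = max a (t - \<delta> / 2)"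
      have c: "a \<le> c" "c \<le> t" "t \<le> b" using Suc.prems \<delta> by (auto simp: c_def)
      have "c - a \<le> real n * (\<delta> / 2)"
        using Suc.prems \<delta> by (auto simp: c_def max_def algebra_simps)
      then have "\<bar>E a c\<bar> \<le> \<epsilon> * N a c" using Suc.IH c by auto
      moreover have "\<bar>E c t\<bar> \<le> \<epsilon> * N c t"
      proof (rule short[OF c])
        show "norm (z s - z s') \<le> \<epsilon>" if "s \<in> {c..t}" "s' \<in> {c..t}" for s s'
        proof -
          have "dist s s' < \<delta>" using that \<delta> by (auto simp: c_def dist_real_def abs_if)
          then show ?thesis using close[of s s'] that c by (simp add: dist_norm)
        qed
      qed
      ultimately show ?case
        using E_add[of a c t] N_add[of a c t] c by (simp add: distrib_left)
    qed
    moreover obtain n where "b - a \<le> real n * (\<delta> / 2)"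
      using ex_less_of_nat_mult[of "\<delta> / 2" "b - a"] \<delta> by (auto intro: less_imp_le)
    ultimately show ?thesis using ab by auto
  qed
  have "N a b \<ge> 0" unfolding N_def by (rule integral_nonneg[OF nw_int]) simp
  have "\<bar>E a b\<bar> \<le> 0"
  proof (rule field_le_epsilon)
    fix e :: real assume "e > 0"
    \<comment> \<open>The summand 1 keeps the denominator positive when
      \<open>N a b = 0\<close>.\<close>
    then have "\<bar>E a b\<bar> \<le> e / (N a b + 1) * N a b"
      using \<open>N a b \<ge> 0\<close> by (intro bound) simp
    also have "\<dots> \<le> e"
      using \<open>e > 0\<close> \<open>N a b \<ge> 0\<close> by (simp add: field_simps)
    finally show "\<bar>E a b\<bar> \<le> 0 + e" by simp
  qed
  then show ?thesis by (simp add: E_def)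
qed

text \<open>\<open>pad0 p\<close> and \<open>block1 p\<close> are adjoint: the padded zeros discard
  the second block of \<open>v\<close>. This is how the sign condition on \<open>r\<close> reaches
  the reduced drift.\<close>

lemma inner_pad0:
  fixes p :: "'k::finite \<Rightarrow> 'n::finite"
  assumes "inj p"
  shows "pad0 p x \<bullet> v = x \<bullet> block1 p v"
proof -
  have "pad0 p x \<bullet> v = (\<Sum>j\<in>range p. x $ inv p j * v $ j)"
    by (simp add: inner_vec_def pad0_def sum.If_cases if_distrib[of "\<lambda>a. a * _"] cong: if_cong)
  also have "\<dots> = x \<bullet> block1 p v"
    by (simp add: sum.reindex[OF assms] inner_vec_def block1_def inv_f_f[OF assms])
  finally show ?thesis .
qed

text \<open>Padding is continuous, each component being a coordinate or 0. Continuity of the output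
  is what makes the supply rate integrable along solutions.\<close>

lemma continuous_on_reduced_h:
  fixes g :: "real^'n \<Rightarrow> real^'m^'n" and p :: "'k::finite \<Rightarrow> 'n"
  assumes "continuous_on UNIV g"
  shows "continuous_on UNIV (reduced_h p g)"
proof -
  have "continuous_on UNIV (\<lambda>x::real^'k. pad0 p x)"
    unfolding pad0_def
  proof (rule continuous_on_vec_lambda)
    show "continuous_on UNIV (\<lambda>x::real^'k. if j \<in> range p then x $ inv p j else 0)" for j
      by (cases "j \<in> range p") (auto intro!: continuous_intros)
  qed
  then have "continuous_on UNIV (\<lambda>x::real^'k. g (pad0 p x))"
    using continuous_on_compose2[OF assms] by blast
  then show ?thesis
    unfolding reduced_h_def reduced_g_def block1_def matrix_vector_mult_def transpose_def
    by (simp, intro continuous_intros)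
qed

lemma solution_upto_continuous_on:
  assumes "solution_upto T f g u z"
  shows "continuous_on {0..T} z"
proof (rule continuous_on_eq)
  show "continuous_on {0..T} (\<lambda>t. z 0 + integral {0..t} (\<lambda>s. f (z s) + g (z s) *v u s))"
    using assms unfolding solution_upto_def absolutely_integrable_on_def
    by (intro continuous_intros indefinite_integral_continuous_1) auto
  show "z 0 + integral {0..t} (\<lambda>s. f (z s) + g (z s) *v u s) = z t" if "t \<in> {0..T}" for t
    using assms that unfolding solution_upto_def by metis
qed

text \<open>The output is the one for which \<open>x \<bullet> (g x *v u)\<close> equals the supply
  rate, so the power balance of \<open>(x \<bullet> x) / 2\<close> differs from the supply only by
  \<open>x \<bullet> f x\<close>, which is nonpositive.\<close>

lemma storage_function_half_square:
  fixes f :: "real^'n \<Rightarrow> real^'n" and g :: "real^'n \<Rightarrow> real^'m^'n"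
  assumes h: "continuous_on UNIV (\<lambda>x. transpose (g x) *v x)"
    and f: "\<And>x. x \<bullet> f x \<le> 0"
  shows "storage_function f g (\<lambda>x. transpose (g x) *v x) (\<lambda>x. (x \<bullet> x) / 2)"
  unfolding storage_function_def
proof (intro conjI allI impI)
  fix u :: "real \<Rightarrow> real^'m" and z t0 t1
  assume u: "control u" and t: "0 \<le> t0" "t0 \<le> t1" and sol: "solution_upto t1 f g u z"
  define w where "w s = f (z s) + g (z s) *v u s" for s
  have sub: "{t0..t1} \<subseteq> {0..t1}" using t by auto
  have w0: "w absolutely_integrable_on {0..t1}"
    and z0: "\<And>t. t \<in> {0..t1} \<Longrightarrow> z t = z 0 + integral {0..t} w"
    using sol unfolding solution_upto_def w_def by blast+
  have w: "w absolutely_integrable_on {t0..t1}"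
    by (rule absolutely_integrable_on_subinterval[OF w0 sub])
  \<comment> \<open>The integral equation is rebased from time 0 to \<open>t0\<close>, the left end
    of the dissipation inequality.\<close>
  have z: "z t = z t0 + integral {t0..t} w" if "t \<in> {t0..t1}" for t
  proof -
    have "integral {0..t0} w + integral {t0..t} w = integral {0..t} w"
      using w0 t that
      by (intro Henstock_Kurzweil_Integration.integral_combine)
        (auto simp: absolutely_integrable_on_def intro: integrable_on_subinterval)
    then show ?thesis using z0[of t0] z0[of t] t that by (simp add: algebra_simps)
  qed
  have cont: "continuous_on {t0..t1} z"
    using continuous_on_subset[OF solution_upto_continuous_on[OF sol] sub] .
  have "continuous_on {t0..t1} (\<lambda>s. transpose (g (z s)) *v z s)"
    using continuous_on_compose2[OF h cont] by simp
  moreover have "u absolutely_integrable_on {t0..t1}"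
    using u sub absolutely_integrable_on_subinterval unfolding control_def by blast
  ultimately have yu: "(\<lambda>s. (transpose (g (z s)) *v z s) \<bullet> u s) absolutely_integrable_on {t0..t1}"
    by (rule absolutely_integrable_continuous_inner)
  have "z t1 \<bullet> z t1 / 2 - z t0 \<bullet> z t0 / 2 = integral {t0..t1} (\<lambda>s. z s \<bullet> w s)"
    using integral_inner_indefinite_integral[OF t(2) w z] by (simp add: diff_divide_distrib)
  also have "\<dots> \<le> integral {t0..t1} (\<lambda>s. (transpose (g (z s)) *v z s) \<bullet> u s)"
  proof (rule integral_le)
    show "(\<lambda>s. z s \<bullet> w s) integrable_on {t0..t1}"
      using absolutely_integrable_continuous_inner[OF cont w]
      by (simp add: absolutely_integrable_on_def)
    show "(\<lambda>s. (transpose (g (z s)) *v z s) \<bullet> u s) integrable_on {t0..t1}"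
      using yu by (simp add: absolutely_integrable_on_def)
    show "z s \<bullet> w s \<le> (transpose (g (z s)) *v z s) \<bullet> u s" for s
      using f[of "z s"] by (simp add: w_def inner_add_right dot_lmul_matrix)
  qed
  finally show "z t1 \<bullet> z t1 / 2 - z t0 \<bullet> z t0 / 2
    \<le> integral {t0..t1} (\<lambda>s. (transpose (g (z s)) *v z s) \<bullet> u s)" .
qed simp

theorem theorem12:
  fixes f :: "real^'n \<Rightarrow> real^'n"
    and g :: "real^'n \<Rightarrow> real^'m^'n"
    and h :: "real^'n \<Rightarrow> real^'m"
    and H Hhat :: "real^'n \<Rightarrow> real"
    and Q R :: "real^'m^'m"
    and r :: "real^'n \<Rightarrow> real^'n"
    and \<kappa> :: nat
    and p :: "'k::finite \<Rightarrow> 'n"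
  assumes continuous: "continuous_on UNIV f" "continuous_on UNIV g" "continuous_on UNIV h"
    and f0: "f 0 = 0"
    and solutions_exist: "\<And>u z0. control u \<Longrightarrow> \<exists>z. solution f g u z0 z"
    and passive_plant: "storage_function f g h H"
    and weights: "sym_pos_semidef Q" "sym_pos_semidef R" "invertible R"
    and Hhat: "Hhat = value_function f g h Q R"
    and admissible: "\<And>z0. admissible_controls f g h Q R z0 \<noteq> {}"
    and Hhat_C1: "Ck_on 1 UNIV Hhat"
    and feedback: "optimal_feedback f g h Q R
        (\<lambda>z. - (matrix_inv R *v (transpose (g z) *v gradient Hhat z)))"
    and kappa: "\<kappa> \<ge> 2"
    and smooth: "Ck_on (\<kappa> + 2) UNIV H" "Ck_on \<kappa> UNIV Hhat"
    and at_0: "H 0 = 0" "Hhat 0 = 0" "gradient H 0 = 0"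
    and hessians: "sym_pos_def (hessian H 0)" "sym_pos_def (hessian Hhat 0)"
    and balancing: "balancing_assumption \<kappa> H Hhat"
    and semibalanced: "semibalanced \<kappa> H Hhat"
    and f_r: "\<And>z. f z = - r (gradient H z)"
    and r_nonneg: "\<And>v. v \<bullet> r v \<ge> 0"
    and p: "inj p"
  shows "passive_system (reduced_f p r) (reduced_g p g) (reduced_h p g)"
proof -
  have h: "reduced_h p g = (\<lambda>x. transpose (reduced_g p g x) *v x)"
    by (rule ext) (rule reduced_h_def)
  have "storage_function (reduced_f p r) (reduced_g p g) (reduced_h p g) (\<lambda>x. (x \<bullet> x) / 2)"
    unfolding h
  proof (rule storage_function_half_square)
    show "continuous_on UNIV (\<lambda>x. transpose (reduced_g p g x) *v x)"
      using continuous_on_reduced_h[OF continuous(2), of p] unfolding h .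
    \<comment> \<open>By adjointness the left side is \<open>- (v \<bullet> r v)\<close> at the
      truncated state \<open>v = pad0 p x\<close>.\<close>
    show "x \<bullet> reduced_f p r x \<le> 0" for x
      using r_nonneg[of "pad0 p x"] by (simp add: reduced_f_def inner_pad0[OF p])
  qed
  then show ?thesis
    unfolding passive_system_def by blast
qed

end
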